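(* For every integer $k\ge 1$, $|I_k(132,213,231)|$ is equal to the number of odd positive divisors of $k$.
   Context: A permutation of length $n$ is a word $\pi=\pi_1\cdots\pi_n$ containing each of $1,\dots,n$ exactly once. The sum of permutations $\rho=\rho_1\cdots\rho_n$ and $\tau=\tau_1\cdots\tau_m$ is the permutation $\rho\oplus\tau=\rho_1\cdots\rho_n(n+\tau_1)\cdots(n+\tau_m)$ of length $n+m$. A permutation is decomposable if it equals $\rho\oplus\tau$ for some non-empty permutations $\rho,\tau$; a non-empty permutation that is not decomposable is indecomposable. An inversion of $\pi$ is a pair $(i,j)$ with $i<j$ and $\pi_i>\pi_j$. A permutation $\pi$ contains a permutation (pattern) $\tau=\tau_1\cdots\tau_m$ if there are indices $i_1<\dots<i_m$ such that $\pi_{i_1},\dots,\pi_{i_m}$ is order-isomorphic to $\tau_1,\dots,\tau_m$; otherwise $\pi$ avoids $\tau$. $I_k(\tau_1,\dots,\tau_r)$ denotes the (finite) set of all indecomposable permutations, of any length, with exactly $k$ inversions that avoid all of $\tau_1,\dots,\tau_r$. *)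

theory Defs
  imports "HOL-Combinatorics.Multiset_Permutations" "HOL-Library.Sublist"
begin

text \<open>
  A permutation of length \<open>n\<close> is the list of its values, a word in \<open>1, \<dots>, n\<close>. List positions
  are counted from \<open>0\<close>.
\<close>

definition is_permutation :: "nat list \<Rightarrow> bool" where
  "is_permutation p \<longleftrightarrow> p \<in> permutations_of_set {1..length p}"

definition perm_sum :: "nat list \<Rightarrow> nat list \<Rightarrow> nat list" where
  "perm_sum r t = r @ map (\<lambda>x. length r + x) t"

definition decomposable :: "nat list \<Rightarrow> bool" where
  "decomposable p \<longleftrightarrow>
     (\<exists>r t. is_permutation r \<and> is_permutation t \<and> r \<noteq> [] \<and> t \<noteq> [] \<and> p = perm_sum r t)"

definition indecomposable :: "nat list \<Rightarrow> bool" where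
  "indecomposable p \<longleftrightarrow> is_permutation p \<and> p \<noteq> [] \<and> \<not> decomposable p"

definition inversions :: "nat list \<Rightarrow> (nat \<times> nat) set" where
  "inversions p = {(i, j). i < j \<and> j < length p \<and> p ! i > p ! j}"

definition order_isomorphic :: "nat list \<Rightarrow> nat list \<Rightarrow> bool" where
  "order_isomorphic u v \<longleftrightarrow>
     length u = length v \<and> (\<forall>i<length u. \<forall>j<length u. u ! i < u ! j \<longleftrightarrow> v ! i < v ! j)"

definition contains :: "nat list \<Rightarrow> nat list \<Rightarrow> bool" where
  "contains p t \<longleftrightarrow> (\<exists>u. subseq u p \<and> order_isomorphic u t)"

definition avoids :: "nat list \<Rightarrow> nat list \<Rightarrow> bool" where
  "avoids p t \<longleftrightarrow> \<not> contains p t"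

definition indecomposable_avoiders :: "nat \<Rightarrow> nat list set \<Rightarrow> nat list set" where
  "indecomposable_avoiders k T =
     {p. indecomposable p \<and> card (inversions p) = k \<and> (\<forall>t\<in>T. avoids p t)}"

end

theory Submission
  imports Defs
begin

text \<open>
  A permutation avoiding 132 and 231 decreases down to its entry 1 and increases from there on.
  If it also avoids 213, every entry before the 1 exceeds every entry after it, so the
  permutation is the word \<open>(m + r) (m + r - 1) \<dots> (m + 1) 1 2 \<dots> m\<close> with \<open>m \<ge> 1\<close>
  (\<open>avoider_eq_valley_perm\<close>). Conversely all such words avoid the three patterns, and for
  \<open>r \<ge> 1\<close> they are indecomposable, because they start with their largest entry. For \<open>r = 0\<close>
  the word is an identity permutation, which has no inversion.

  Exactly the pairs whose first position is among the first \<open>r\<close> are inversions, so their number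
  is \<open>m + (m + 1) + \<dots> + (m + r - 1) = r (r + 2 m - 1) / 2\<close>. Hence the permutations
  with \<open>k \<ge> 1\<close> inversions correspond to the ways of writing \<open>k\<close> as a sum of consecutive
  positive integers, that is, to the factorizations \<open>2 k = r q\<close> with \<open>r < q\<close> and \<open>r\<close>, \<open>q\<close> of
  opposite parity. Such a factorization is determined by its odd factor, which can be any odd
  divisor of \<open>k\<close> (\<open>card_runs_with_sum\<close>).
\<close>

section \<open>Subsequences and patterns of length three\<close>

lemma sorted_wrt_iff_subseq:
  "sorted_wrt R xs \<longleftrightarrow> (\<forall>x y. subseq [x, y] xs \<longrightarrow> R x y)"
proof (induction xs)
  case Nil
  then show ?case by simp
next
  case (Cons a xs)
  have "subseq [x, y] (a # xs) \<longleftrightarrow> x = a \<and> y \<in> set xs \<or> subseq [x, y] xs" for x y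
    by (auto simp: subseq_singleton_left subseq_Cons2_iff dest: subseq_Cons')
  with Cons.IH show ?case by auto
qed

lemma distinct_subseq:
  assumes "distinct ys" "subseq xs ys"
  shows "distinct xs"
  using assms by (auto simp: subseq_conv_nths distinct_nthsI)

lemma contains_length_3_iff:
  "contains p [a, b, c] \<longleftrightarrow> (\<exists>x y z. subseq [x, y, z] p \<and> order_isomorphic [x, y, z] [a, b, c])"
proof
  assume "contains p [a, b, c]"
  then obtain u where u: "subseq u p" "order_isomorphic u [a, b, c]"
    by (auto simp: contains_def)
  from u(2) have "length u = 3" by (simp add: order_isomorphic_def)
  then obtain x y z where "u = [x, y, z]"
    by (auto simp: numeral_3_eq_3 length_Suc_conv)
  with u show "\<exists>x y z. subseq [x, y, z] p \<and> order_isomorphic [x, y, z] [a, b, c]" by blast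
qed (auto simp: contains_def)

lemma order_isomorphic_length_3_iff:
  "order_isomorphic [x, y, z] [a, b, c] \<longleftrightarrow>
     (x < y \<longleftrightarrow> a < b) \<and> (y < x \<longleftrightarrow> b < a) \<and> (x < z \<longleftrightarrow> a < c) \<and> (z < x \<longleftrightarrow> c < a) \<and>
     (y < z \<longleftrightarrow> b < c) \<and> (z < y \<longleftrightarrow> c < b)"
  by (simp add: order_isomorphic_def All_less_Suc) (simp only: conj_ac)

lemma avoids_132_iff:
  "avoids p [1, 3, 2] \<longleftrightarrow> (\<forall>x y z. subseq [x, y, z] p \<longrightarrow> \<not> (x < z \<and> z < y))"
proof -
  have "order_isomorphic [x, y, z] [1, 3, 2] \<longleftrightarrow> x < z \<and> z < y" for x y z
    by (auto simp: order_isomorphic_length_3_iff)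
  then show ?thesis
    unfolding avoids_def contains_length_3_iff by blast
qed

lemma avoids_213_iff:
  "avoids p [2, 1, 3] \<longleftrightarrow> (\<forall>x y z. subseq [x, y, z] p \<longrightarrow> \<not> (y < x \<and> x < z))"
proof -
  have "order_isomorphic [x, y, z] [2, 1, 3] \<longleftrightarrow> y < x \<and> x < z" for x y z
    by (auto simp: order_isomorphic_length_3_iff)
  then show ?thesis
    unfolding avoids_def contains_length_3_iff by blast
qed

lemma avoids_231_iff:
  "avoids p [2, 3, 1] \<longleftrightarrow> (\<forall>x y z. subseq [x, y, z] p \<longrightarrow> \<not> (z < x \<and> x < y))"
proof -
  have "order_isomorphic [x, y, z] [2, 3, 1] \<longleftrightarrow> z < x \<and> x < y" for x y z
    by (auto simp: order_isomorphic_length_3_iff)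
  then show ?thesis
    unfolding avoids_def contains_length_3_iff by blast
qed

lemma is_permutation_iff: "is_permutation p \<longleftrightarrow> distinct p \<and> set p = {1..length p}"
  by (auto simp: is_permutation_def permutations_of_set_def)

section \<open>The avoiding permutations\<close>

text \<open>The word \<open>(m + r) \<dots> (m + 1) 1 \<dots> m\<close>, with \<open>r\<close> entries in front of the entry 1.\<close>

definition valley_perm :: "nat \<Rightarrow> nat \<Rightarrow> nat list" where
  "valley_perm m r = rev [Suc m..<Suc (m + r)] @ [1..<Suc m]"

lemma length_valley_perm [simp]: "length (valley_perm m r) = m + r"
  by (simp add: valley_perm_def)

lemma is_permutation_valley_perm: "is_permutation (valley_perm m r)"
  by (auto simp: is_permutation_iff valley_perm_def)

lemma hd_valley_perm: "r \<ge> 1 \<Longrightarrow> hd (valley_perm m r) = m + r"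
  by (simp add: valley_perm_def hd_append hd_rev)

lemma last_valley_perm: "m \<ge> 1 \<Longrightarrow> last (valley_perm m r) = m"
  by (simp add: valley_perm_def)

lemma valley_perm_inj:
  assumes "valley_perm m r = valley_perm m' r'" "m \<ge> 1" "m' \<ge> 1"
  shows "m = m' \<and> r = r'"
proof -
  have "m = m'"
    using arg_cong[OF assms(1), of last] assms(2,3) by (simp only: last_valley_perm)
  moreover have "m + r = m' + r'"
    using arg_cong[OF assms(1), of length] by (simp only: length_valley_perm)
  ultimately show ?thesis by simp
qed

text \<open>How two entries of \<open>valley_perm\<close> compare depends only on whether the earlier one is
  larger than \<open>m\<close>. Avoidance and the number of inversions both follow from this.\<close>

lemma sorted_wrt_valley_perm:
  "sorted_wrt (\<lambda>x y. m < x \<and> y < x \<or> x \<le> m \<and> y \<le> m \<and> x < y) (valley_perm m r)"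
proof -
  have "sorted_wrt (\<lambda>x y. m < x \<and> y < x \<or> x \<le> m \<and> y \<le> m \<and> x < y) (rev [Suc m..<Suc (m + r)])"
    unfolding sorted_wrt_rev
    by (rule sorted_wrt_mono_rel[OF _ sorted_wrt_upt]) auto
  moreover have "sorted_wrt (\<lambda>x y. m < x \<and> y < x \<or> x \<le> m \<and> y \<le> m \<and> x < y) [1..<Suc m]"
    by (rule sorted_wrt_mono_rel[OF _ sorted_wrt_upt]) auto
  ultimately show ?thesis
    by (auto simp: valley_perm_def sorted_wrt_append)
qed

lemma valley_perm_avoids:
  assumes "t \<in> {[1,3,2], [2,1,3], [2,3,1]}"
  shows "avoids (valley_perm m r) t"
proof -
  have "\<not> (x < z \<and> z < y) \<and> \<not> (y < x \<and> x < z) \<and> \<not> (z < x \<and> x < y)"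
    if xyz: "subseq [x, y, z] (valley_perm m r)" for x y z
  proof -
    have sub: "subseq [x, y] [x, y, z]" "subseq [x, z] [x, y, z]" "subseq [y, z] [x, y, z]"
      by auto
    have pair: "m < u \<and> v < u \<or> u \<le> m \<and> v \<le> m \<and> u < v" if "subseq [u, v] [x, y, z]" for u v
      using sorted_wrt_valley_perm[of m r] subseq_order.order_trans[OF that xyz]
      unfolding sorted_wrt_iff_subseq by blast
    show ?thesis
      using pair[OF sub(1)] pair[OF sub(2)] pair[OF sub(3)] by linarith
  qed
  then have "avoids (valley_perm m r) [1,3,2]" "avoids (valley_perm m r) [2,1,3]"
    "avoids (valley_perm m r) [2,3,1]"
    unfolding avoids_132_iff avoids_213_iff avoids_231_iff by blast+
  with assms show ?thesis by blast
qed

lemma indecomposable_valley_perm: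
  assumes "r \<ge> 1"
  shows "indecomposable (valley_perm m r)"
proof -
  have "\<not> decomposable (valley_perm m r)"
  proof
    assume "decomposable (valley_perm m r)"
    then obtain s t where s: "is_permutation s" "s \<noteq> []" "t \<noteq> []"
      and eq: "valley_perm m r = perm_sum s t"
      by (auto simp: decomposable_def)
    have "hd s = m + r"
      using hd_valley_perm[OF assms, of m] eq s(2) by (simp add: perm_sum_def)
    moreover have "hd s \<in> {1..length s}"
      using s(1,2) hd_in_set[of s] by (simp add: is_permutation_iff)
    moreover have "m + r = length s + length t"
      using arg_cong[OF eq, of length] by (simp add: perm_sum_def)
    ultimately show False using s(3) by simp
  qed
  moreover have "valley_perm m r \<noteq> []"
    using assms length_valley_perm[of m r] by (metis add_is_0 list.size(3) not_one_le_zero)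
  ultimately show ?thesis
    by (simp add: indecomposable_def is_permutation_valley_perm)
qed

lemma avoider_eq_valley_perm:
  assumes p: "is_permutation p" "p \<noteq> []"
    and avoid: "avoids p [1,3,2]" "avoids p [2,1,3]" "avoids p [2,3,1]"
  obtains m r where "m \<ge> 1" "p = valley_perm m r"
proof -
  have dist: "distinct p" and set_p: "set p = {1..length p}"
    using p(1) by (auto simp: is_permutation_iff)
  have "length p \<ge> 1" using p(2) by (cases p) auto
  then have "1 \<in> set p" unfolding set_p by simp
  then obtain xs ys where eq: "p = xs @ 1 # ys" by (meson split_list)
  have gt1: "x > 1" if "x \<in> set xs \<union> set ys" for x
  proof -
    have "x \<in> set p" using that eq by auto
    moreover have "x \<noteq> 1" using that dist eq by auto
    ultimately show ?thesis unfolding set_p by simp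
  qed
  \<comment> \<open>A pair \<open>x < y\<close> before the entry 1 would form the pattern 231 together with the 1.\<close>
  have "y < x" if "subseq [x, y] xs" for x y
  proof -
    have "subseq ([x, y] @ [1]) (xs @ 1 # ys)"
      using that by (intro list_emb_append_mono) auto
    then have "\<not> (1 < x \<and> x < y)"
      using avoid(3) unfolding avoids_231_iff eq by simp
    moreover have "x \<in> set xs"
      using list_emb_set[OF that, of x] by force
    moreover have "x \<noteq> y"
      using distinct_subseq[OF _ that] dist eq by simp
    ultimately show ?thesis using gt1 by force
  qed
  then have xs: "sorted_wrt (\<lambda>x y. y < x) xs"
    by (simp add: sorted_wrt_iff_subseq)
  \<comment> \<open>A pair \<open>x > y\<close> after the entry 1 would form the pattern 132 together with the 1.\<close>
  have "x < y" if "subseq [x, y] ys" for x y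
  proof -
    have "subseq ([] @ [1, x, y]) (xs @ 1 # ys)"
      using that by (intro list_emb_append_mono) auto
    then have "\<not> (1 < y \<and> y < x)"
      using avoid(1) unfolding avoids_132_iff eq by simp
    moreover have "y \<in> set ys"
      using list_emb_set[OF that, of y] by force
    moreover have "x \<noteq> y"
      using distinct_subseq[OF _ that] dist eq by simp
    ultimately show ?thesis using gt1 by force
  qed
  then have ys: "sorted_wrt (<) ys"
    by (simp add: sorted_wrt_iff_subseq)
  \<comment> \<open>Otherwise \<open>x 1 y\<close> would form the pattern 213.\<close>
  have yx: "y < x" if "x \<in> set xs" "y \<in> set ys" for x y
  proof -
    have "subseq ([x] @ [1, y]) (xs @ 1 # ys)"
      using that by (intro list_emb_append_mono) (auto simp: subseq_singleton_left)
    then have "\<not> (1 < x \<and> x < y)"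
      using avoid(2) unfolding avoids_213_iff eq by simp
    moreover have "x \<noteq> y" using that dist eq by auto
    ultimately show ?thesis using gt1 that by force
  qed
  define m r where "m = Suc (length ys)" and "r = length xs"
  \<comment> \<open>Moving the reversed initial part behind the rest sorts the word.\<close>
  have "sorted_wrt (<) ((1 # ys) @ rev xs)"
    using xs ys yx gt1 by (auto simp: sorted_wrt_append sorted_wrt_rev)
  moreover have "set ((1 # ys) @ rev xs) = set [1..<Suc (m + r)]"
  proof -
    have "set ((1 # ys) @ rev xs) = set p"
      unfolding eq by auto
    moreover have "length p = m + r"
      unfolding eq m_def r_def by simp
    ultimately show ?thesis
      unfolding set_p set_upt by (simp only: atLeastLessThanSuc_atLeastAtMost)
  qed
  ultimately have sorted: "(1 # ys) @ rev xs = [1..<Suc (m + r)]"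
    by (intro strict_sorted_equal) (auto simp del: upt_Suc)
  also have "\<dots> = [1..<Suc m] @ [Suc m..<Suc (m + r)]"
    using upt_add_eq_append[of 1 "Suc m" r] by simp
  finally have "(1 # ys) @ rev xs = [1..<Suc m] @ [Suc m..<Suc (m + r)]" .
  moreover have "length (1 # ys) = length [1..<Suc m]"
    by (simp add: m_def del: upt_Suc)
  ultimately have "1 # ys = [1..<Suc m]" "rev xs = [Suc m..<Suc (m + r)]"
    by (metis append_eq_append_conv)+
  then have "p = valley_perm m r"
    unfolding eq valley_perm_def by (metis rev_rev_ident)
  with that[of m r] show thesis by (simp add: m_def)
qed

lemma inversions_valley_perm:
  "inversions (valley_perm m r) = (SIGMA i:{..<r}. {i<..<m + r})"
proof -
  let ?p = "valley_perm m r"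
  have big: "m < ?p ! i \<longleftrightarrow> i < r" if "i < m + r" for i
    using that by (auto simp: valley_perm_def nth_append rev_nth simp del: upt_Suc)
  have "?p ! j < ?p ! i \<longleftrightarrow> i < r" if "i < j" "j < m + r" for i j
    using sorted_wrt_nth_less[OF sorted_wrt_valley_perm[of m r] that(1)] that big[of i] by auto
  then show ?thesis by (auto simp: inversions_def)
qed

lemma card_inversions_valley_perm:
  assumes "m \<ge> 1"
  shows "2 * card (inversions (valley_perm m r)) = r * (r + 2 * m - 1)"
proof -
  have "2 * (\<Sum>i<r. m + r - Suc i) = r * (r + 2 * m - 1)"
  proof (induction r)
    case (Suc r)
    have "2 * (\<Sum>i<Suc r. m + Suc r - Suc i) = 2 * (m + r) + 2 * (\<Sum>i<r. m + r - Suc i)"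
      by (subst sum.lessThan_Suc_shift) simp
    also have "\<dots> = 2 * (m + r) + r * (r + 2 * m - 1)"
      using Suc.IH by simp
    also have "\<dots> = Suc r * (Suc r + 2 * m - 1)"
      using assms by (cases m) (auto simp: algebra_simps)
    finally show ?case .
  qed simp
  then show ?thesis by (simp add: inversions_valley_perm)
qed

lemma indecomposable_avoiders_eq:
  assumes "k \<ge> 1"
  shows "indecomposable_avoiders k {[1,3,2], [2,1,3], [2,3,1]} =
    (\<lambda>(m, r). valley_perm m r) ` {(m, r). m \<ge> 1 \<and> r * (r + 2 * m - 1) = 2 * k}"
    (is "?A = ?f ` ?P")
proof (intro equalityI subsetI)
  fix p assume "p \<in> ?A"
  then have "is_permutation p" "p \<noteq> []" "avoids p [1,3,2]" "avoids p [2,1,3]" "avoids p [2,3,1]"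
    and card: "card (inversions p) = k"
    by (auto simp: indecomposable_avoiders_def indecomposable_def)
  then obtain m r where "m \<ge> 1" "p = valley_perm m r"
    using avoider_eq_valley_perm by blast
  with card card_inversions_valley_perm[of m r] show "p \<in> ?f ` ?P" by auto
next
  fix p assume "p \<in> ?f ` ?P"
  then obtain m r where p: "p = valley_perm m r" and m: "m \<ge> 1"
    and k: "r * (r + 2 * m - 1) = 2 * k" by auto
  have "r \<ge> 1" using k assms by (cases r) auto
  then have "indecomposable p" unfolding p by (rule indecomposable_valley_perm)
  moreover have "card (inversions p) = k"
    using card_inversions_valley_perm[OF m, of r] k by (simp add: p)
  ultimately show "p \<in> ?A"
    using valley_perm_avoids by (auto simp: indecomposable_avoiders_def p)
qed

section \<open>Sums of consecutive integers and odd divisors\<close>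

text \<open>The pair \<open>(m, r)\<close> stands for the run \<open>m, m + 1, \<dots>, m + r - 1\<close>, whose sum is
  \<open>r (r + 2 m - 1) / 2\<close>.\<close>

lemma card_runs_with_sum:
  fixes k :: nat
  assumes "k \<ge> 1"
  shows "card {(m, r). m \<ge> 1 \<and> r * (r + 2 * m - 1) = 2 * k} = card {d. 0 < d \<and> odd d \<and> d dvd k}"
    (is "card ?P = card ?D")
proof (rule bij_betw_same_card)
  \<comment> \<open>The factors \<open>r\<close> and \<open>r + 2 m - 1\<close> have opposite parity; take the odd one.\<close>
  let ?f = "\<lambda>(m, r). if odd r then r else r + 2 * m - 1"
  have odd_dvd: "d dvd k" if "odd d" "d * e = 2 * k" for d e :: nat
    using that by (metis coprime_dvd_mult_right_iff coprime_right_2_iff_odd dvd_triv_left)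
  show "bij_betw ?f ?P ?D"
    unfolding bij_betw_def
  proof
    show "inj_on ?f ?P"
    proof (intro inj_onI, clarify)
      fix m r m' r' :: nat
      assume m: "1 \<le> m" "1 \<le> m'"
        and k: "r * (r + 2 * m - 1) = 2 * k" "r' * (r' + 2 * m' - 1) = 2 * k"
        and f: "(if odd r then r else r + 2 * m - 1) = (if odd r' then r' else r' + 2 * m' - 1)"
      define q q' where "q = r + 2 * m - 1" and "q' = r' + 2 * m' - 1"
      have less: "r < q" "r' < q'" using m by (auto simp: q_def q'_def)
      have pos: "0 < r" "0 < r'" using k assms by (auto intro!: Nat.gr0I)
      have k': "r * q = r' * q'" using k by (simp add: q_def q'_def)
      have "r = r' \<or> r = q' \<or> q = r' \<or> q = q'"
        using f unfolding q_def[symmetric] q'_def[symmetric] by argo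
      with k' pos less have "r = r' \<and> q = q' \<or> r = q' \<and> q = r'"
        by (auto simp: mult.commute)
      with less have "r = r'" "q = q'" by auto
      with m show "m = m' \<and> r = r'" by (simp add: q_def q'_def)
    qed
    show "?f ` ?P = ?D"
    proof (intro equalityI subsetI)
      fix d assume "d \<in> ?f ` ?P"
      then obtain m r where m: "m \<ge> 1" and k: "r * (r + 2 * m - 1) = 2 * k"
        and d: "d = (if odd r then r else r + 2 * m - 1)" by auto
      have "odd d" using m d by auto
      moreover have "d dvd k"
      proof (cases "odd r")
        case True
        then show ?thesis using odd_dvd[of r "r + 2 * m - 1"] k d by simp
      next
        case False
        then show ?thesis
          using odd_dvd[of "r + 2 * m - 1" r] k d \<open>odd d\<close> by (simp add: mult.commute)
      qed
      ultimately show "d \<in> ?D" by (auto intro: odd_pos)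
    next
      fix d assume "d \<in> ?D"
      then have d: "odd d" "0 < d" and "d dvd k" by auto
      then obtain c where c: "k = d * c" by auto
      \<comment> \<open>Since \<open>2 k = d (2 c)\<close>, the smaller of the factors \<open>d\<close> and \<open>2 c\<close> is \<open>r\<close>.\<close>
      have "d \<noteq> 2 * c" using d(1) by auto
      then consider "d < 2 * c" | "2 * c < d" by linarith
      then show "d \<in> ?f ` ?P"
      proof cases
        case 1
        define m where "m = (2 * c - d + 1) div 2"
        have "d + 2 * m - 1 = 2 * c" "m \<ge> 1"
          using 1 d unfolding m_def by presburger+
        then show ?thesis
          using c d by (intro image_eqI[of _ _ "(m, d)"]) auto
      next
        case 2
        define m where "m = (d - 2 * c + 1) div 2"
        have "2 * c + 2 * m - 1 = d" "m \<ge> 1"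
          using 2 d unfolding m_def by presburger+
        then show ?thesis
          using c d by (intro image_eqI[of _ _ "(m, 2 * c)"]) auto
      qed
    qed
  qed
qed

theorem theorem22:
  fixes k :: nat
  assumes "k \<ge> 1"
  shows "card (indecomposable_avoiders k {[1,3,2], [2,1,3], [2,3,1]}) =
         card {d :: nat. 0 < d \<and> odd d \<and> d dvd k}"
proof -
  have "inj_on (\<lambda>(m, r). valley_perm m r) {(m, r). m \<ge> 1 \<and> r * (r + 2 * m - 1) = 2 * k}"
    using valley_perm_inj by (force intro!: inj_onI)
  then show ?thesis
    unfolding indecomposable_avoiders_eq[OF assms]
    by (simp only: card_image card_runs_with_sum[OF assms])
qed

end
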